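(* Let $x\in\mathbb{R}$ and $y\in\mathbb{C}$. Then $$\sum_{s=0}^{\infty}\Phi_{2s+1}(x)\,y^{2s+1}+\sum_{s=0}^{\infty}\Phi_{2s}(x)\,y^{2s}=\frac{1+y}{\sqrt{y^{2}+1}}\sinh\left(x\sqrt{y^{2}+1}\right)+\cosh\left(x\sqrt{y^{2}+1}\right).$$
   Context: Let $\Gamma_r(t)=re^{it}$, $t\in[0,2\pi]$, with $r>1$. Define, for integers $s\ge 0$, $$\Phi_{2s+1}(x):=\frac{1}{2\pi i}\int_{\Gamma_r}\frac{e^{xz}}{(z-1)^{s+1}(z+1)^{s+1}}\,dz,\qquad \Phi_{2s}(x):=\frac{1}{2\pi i}\int_{\Gamma_r}\frac{e^{xz}}{(z-1)^{s+1}(z+1)^{s}}\,dz.$$ Since $\sinh(w)/w$ and $\cosh(w)$ are even entire functions of $w$, the right-hand side does not depend on the choice of the square root; at $y=\pm i$ the quotient $\sinh(x\sqrt{y^2+1})/\sqrt{y^2+1}$ is understood as its limit value $x$. *)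

theory Defs
  imports "HOL-Complex_Analysis.Complex_Analysis"
begin

text \<open>
  \<^term>\<open>circlepath 0 r\<close> is the circle of radius \<^term>\<open>r\<close> about the origin, traversed once
  counterclockwise, but parametrised over the unit interval instead of \<open>[0, 2\<pi>]\<close>; this does not
  affect the contour integral.  The radius is kept as an explicit parameter.
\<close>

definition Phi :: "real \<Rightarrow> nat \<Rightarrow> real \<Rightarrow> complex" where
  "Phi r m x =
    (let s = m div 2 in
     if odd m
     then 1 / (2 * of_real pi * \<i>) *
       contour_integral (circlepath 0 r)
         (\<lambda>z. exp (of_real x * z) / ((z - 1) ^ (s + 1) * (z + 1) ^ (s + 1)))
     else 1 / (2 * of_real pi * \<i>) *
       contour_integral (circlepath 0 r)
         (\<lambda>z. exp (of_real x * z) / ((z - 1) ^ (s + 1) * (z + 1) ^ s)))"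

text \<open>
  The quotient \<open>sinh (x w) / w\<close>, with its limit value \<open>x\<close> at the removable singularity \<open>w = 0\<close>
  (HOL division would give \<open>0\<close> there).
\<close>

definition sinh_quot :: "real \<Rightarrow> complex \<Rightarrow> complex" where
  "sinh_quot x w = (if w = 0 then of_real x else sinh (of_real x * w) / w)"

lemma sinh_quot_minus: "sinh_quot x (- w) = sinh_quot x w"
  by (simp add: sinh_quot_def)

lemma sinh_quot_limit: "((\<lambda>w. sinh (of_real x * w) / w) \<longlongrightarrow> sinh_quot x 0) (at 0)"
proof -
  have "((\<lambda>w::complex. sinh (of_real x * w)) has_field_derivative of_real x) (at 0)"
    by (auto intro!: derivative_eq_intros)
  then show ?thesis
    by (simp add: has_field_derivative_iff sinh_quot_def)
qed

end

theory Submission imports Defs begin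

text \<open>
  The contour may be enlarged to any circle of radius greater than 1, because the poles
  \<open>1\<close> and \<open>- 1\<close> stay inside.  On a large circle both series are geometric with
  ratio \<open>y\<^sup>2 / (z\<^sup>2 - 1)\<close>, and summing them under the integral turns the left-hand side into the
  contour integral of \<open>exp (x z) (1 + y + z) / (z\<^sup>2 - w\<^sup>2)\<close>, which Cauchy's formula evaluates.
\<close>

text \<open>By the residue theorem: every point of \<open>P\<close> has winding number 1 about
  either circle, so both integrals equal 2 pi i times the same sum of residues.\<close>

lemma contour_integral_circlepath_radius_cong:
  assumes "finite P" "P \<subseteq> ball c r" "P \<subseteq> ball c R" "0 < r" "0 < R" "f holomorphic_on - P"
  shows "contour_integral (circlepath c r) f = contour_integral (circlepath c R) f"
proof -
  have *: "contour_integral (circlepath c q) f = 2 * pi * \<i> * (\<Sum>p\<in>P. residue f p)"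
    if q: "P \<subseteq> ball c q" "0 < q" for q
  proof -
    have "contour_integral (circlepath c q) f =
        2 * pi * \<i> * (\<Sum>p\<in>P. winding_number (circlepath c q) p * residue f p)"
      using q assms(1,6) by (intro Residue_theorem[of UNIV]) (auto simp: Compl_eq_Diff_UNIV)
    also have "(\<Sum>p\<in>P. winding_number (circlepath c q) p * residue f p) = (\<Sum>p\<in>P. residue f p)"
      using q by (intro sum.cong refl)
        (auto simp: winding_number_circlepath dist_norm norm_minus_commute subset_iff)
    finally show ?thesis .
  qed
  show ?thesis
    using assms *[of r] *[of R] by simp
qed

text \<open>Summation and integration may be exchanged because the geometric series converges
  uniformly on the circle, with majorant \<open>B * C ^ n\<close> where \<open>B\<close> bounds
  \<open>g\<close> by compactness.\<close>

lemma contour_integral_circlepath_geometric_sums: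
  fixes g q :: "complex \<Rightarrow> complex"
  assumes R: "0 < R" and C: "C < 1"
    and g: "continuous_on (sphere c R) g" and q: "continuous_on (sphere c R) q"
    and qC: "\<And>z. z \<in> sphere c R \<Longrightarrow> norm (q z) \<le> C"
  shows "(\<lambda>s. contour_integral (circlepath c R) (\<lambda>z. g z * q z ^ s)) sums
      contour_integral (circlepath c R) (\<lambda>z. g z / (1 - q z))"
proof -
  have "compact (g ` sphere c R)"
    by (intro compact_continuous_image g) auto
  then have "\<exists>B. \<forall>z\<in>sphere c R. norm (g z) \<le> B"
    by (auto dest!: compact_imp_bounded simp: bounded_iff)
  then obtain B where B: "norm (g z) \<le> B" if "z \<in> sphere c R" for z
    by blast
  \<comment> \<open>The sign of \<open>C\<close> comes from evaluating \<open>qC\<close> at one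
    point of the circle; the majorant series then has ratio in [0, 1).\<close>
  have C0: "0 \<le> C"
    using order_trans[OF norm_ge_zero qC[of "c + of_real R"]] R by (simp add: dist_norm)
  have sums: "(\<lambda>s. g z * q z ^ s) sums (g z / (1 - q z))" if "z \<in> sphere c R" for z
    using sums_mult[OF geometric_sums, of "q z" "g z"] qC[OF that] C by simp
  have "uniform_limit (sphere c R) (\<lambda>n z. \<Sum>s<n. g z * q z ^ s) (\<lambda>z. \<Sum>s. g z * q z ^ s) sequentially"
  proof (rule Weierstrass_m_test)
    show "norm (g z * q z ^ n) \<le> B * C ^ n" if "z \<in> sphere c R" for n z
      using B[OF that] qC[OF that] order_trans[OF norm_ge_zero B[OF that]]
      by (auto simp: norm_mult norm_power intro!: mult_mono power_mono)
    show "summable (\<lambda>n. B * C ^ n)"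
      using C C0 by (intro summable_mult summable_geometric) auto
  qed
  then have lim: "uniform_limit (sphere c R) (\<lambda>n z. \<Sum>s<n. g z * q z ^ s)
      (\<lambda>z. g z / (1 - q z)) sequentially"
    by (rule uniform_limit_cong'[THEN iffD1, rotated -1]) (simp_all add: sums_unique[OF sums, symmetric])
  have int: "(\<lambda>z. g z * q z ^ s) contour_integrable_on circlepath c R" for s
    using R by (intro contour_integrable_continuous_circlepath continuous_intros)
      (auto intro: g q)
  have "(\<lambda>n. contour_integral (circlepath c R) (\<lambda>z. \<Sum>s<n. g z * q z ^ s)) \<longlonglongrightarrow>
      contour_integral (circlepath c R) (\<lambda>z. g z / (1 - q z))"
    using lim R int
    by (intro contour_integral_uniform_limit_circlepath[where F = sequentially])
      (auto intro!: contour_integrable_sum always_eventually)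
  then show ?thesis
    by (simp add: sums_def contour_integral_sum int)
qed

text \<open>For nonzero \<open>w\<close>, partial fractions split the integrand into simple poles at
  \<open>w\<close> and \<open>- w\<close>, and Cauchy's formula applies to each. For
  \<open>w = 0\<close> the poles merge into a double pole, and the formula for the first derivative
  takes over.\<close>

lemma has_contour_integral_exp_div_squares:
  fixes x R :: real and b w :: complex
  assumes "norm w < R"
  shows "((\<lambda>z. exp (of_real x * z) * (b + z) / (z\<^sup>2 - w\<^sup>2)) has_contour_integral
      2 * of_real pi * \<i> * (b * sinh_quot x w + cosh (of_real x * w))) (circlepath 0 R)"
proof (cases "w = 0")
  case True
  define f where "f = (\<lambda>z. exp (of_real x * z) * (b + z))"
  have hol: "f holomorphic_on A" for A
    unfolding f_def by (intro holomorphic_intros)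
  \<comment> \<open>The coefficient of \<open>b\<close> in this derivative is \<open>x\<close>,
    which is exactly the limit value built into \<open>sinh_quot x 0\<close>; the summand 1 is cosh
    0.\<close>
  have "(f has_field_derivative (b * of_real x + 1)) (at 0)"
    unfolding f_def by (auto intro!: derivative_eq_intros)
  then have "deriv f 0 = b * of_real x + 1"
    by (rule DERIV_imp_deriv)
  moreover have "((\<lambda>u. f u / (u - 0) ^ Suc 1) has_contour_integral
      2 * pi * \<i> / fact 1 * (deriv ^^ 1) f 0) (circlepath 0 R)"
    using assms True hol
    by (intro Cauchy_has_contour_integral_higher_derivative_circlepath
        holomorphic_on_imp_continuous_on) auto
  ultimately show ?thesis
    using True by (simp add: f_def sinh_quot_def power2_eq_square)
next
  case False
  define f where "f = (\<lambda>z. exp (of_real x * z) * (b + z))"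
  have hol: "f holomorphic_on A" for A
    unfolding f_def by (intro holomorphic_intros)
  have cauchy: "((\<lambda>u. f u / (u - v)) has_contour_integral 2 * of_real pi * \<i> * f v) (circlepath 0 R)"
    if "norm v < R" for v
    using that by (intro Cauchy_integral_circlepath_simple hol) auto
  have "((\<lambda>u. (f u / (u - w) - f u / (u - - w)) / (2 * w)) has_contour_integral
      (2 * of_real pi * \<i> * f w - 2 * of_real pi * \<i> * f (- w)) / (2 * w)) (circlepath 0 R)"
    using assms by (intro has_contour_integral_div has_contour_integral_diff cauchy) auto
  \<comment> \<open>Here \<open>f w - f (- w)\<close> equals 2 (\<open>b\<close> sinh(xw) +
    \<open>w\<close> cosh(xw)).\<close>
  moreover have "(2 * of_real pi * \<i> * f w - 2 * of_real pi * \<i> * f (- w)) / (2 * w) =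
      2 * of_real pi * \<i> * (b * sinh_quot x w + cosh (of_real x * w))"
    using False by (simp add: f_def sinh_quot_def sinh_field_def cosh_field_def field_simps)
  ultimately have *: "((\<lambda>u. (f u / (u - w) - f u / (u - - w)) / (2 * w)) has_contour_integral
      2 * of_real pi * \<i> * (b * sinh_quot x w + cosh (of_real x * w))) (circlepath 0 R)"
    by simp
  show ?thesis
  proof (rule has_contour_integral_eq[OF *])
    fix u assume "u \<in> path_image (circlepath 0 R)"
    then have "norm u = R"
      using assms norm_ge_zero[of w] by auto
    then have "u \<noteq> w" "u \<noteq> - w"
      using assms by auto
    then have "u - w \<noteq> 0" "u + w \<noteq> 0"
      by (auto simp: eq_neg_iff_add_eq_0)
    moreover have "u\<^sup>2 - w\<^sup>2 = (u - w) * (u + w)"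
      by (simp add: power2_eq_square algebra_simps)
    ultimately show "(f u / (u - w) - f u / (u - - w)) / (2 * w) =
        exp (of_real x * u) * (b + u) / (u\<^sup>2 - w\<^sup>2)"
      using False by (simp add: f_def divide_simps) (simp add: algebra_simps)
  qed
qed

text \<open>The integrands are singular at most at 1 and -1, inside both circles. This frees the
  radius to depend on \<open>y\<close> and \<open>w\<close>.\<close>

lemma Phi_radius_cong:
  assumes "1 < r" "1 < R"
  shows "Phi r m x = Phi R m x"
proof -
  have *: "contour_integral (circlepath 0 r) (\<lambda>z. exp (of_real x * z) / ((z - 1) ^ j * (z + 1) ^ k)) =
      contour_integral (circlepath 0 R) (\<lambda>z. exp (of_real x * z) / ((z - 1) ^ j * (z + 1) ^ k))" for j k
    using assms
    by (intro contour_integral_circlepath_radius_cong[where P = "{1, -1}"] holomorphic_intros)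
      (auto simp: eq_neg_iff_add_eq_0)
  show ?thesis
    unfolding Phi_def Let_def * ..
qed

text \<open>Either square root is allowed as \<open>w\<close>, so independence of the choice is
  included. Summability is asserted separately since \<open>suminf\<close> is meaningful only for
  convergent series.\<close>

theorem theorem17:
  fixes r x :: real and y w :: complex
  assumes "r > 1"
    and "w\<^sup>2 = y\<^sup>2 + 1"
  shows "summable (\<lambda>s. Phi r (2 * s + 1) x * y ^ (2 * s + 1)) \<and>
    summable (\<lambda>s. Phi r (2 * s) x * y ^ (2 * s)) \<and>
    (\<Sum>s. Phi r (2 * s + 1) x * y ^ (2 * s + 1)) + (\<Sum>s. Phi r (2 * s) x * y ^ (2 * s)) =
      (1 + y) * sinh_quot x w + cosh (of_real x * w)"
proof -
  \<comment> \<open>Exceeding \<open>norm w\<close> puts both \<open>w\<close> and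
    \<open>- w\<close> inside the circle; being at least \<open>norm y + 2\<close> gives
    \<open>R\<^sup>2 - 1 > (norm y)\<^sup>2\<close>, so the ratio \<open>q\<close> is bounded by
    \<open>C < 1\<close> on it.\<close>
  define R where "R = norm y + norm w + 2"
  define C where "C = (norm y)\<^sup>2 / (R\<^sup>2 - 1)"
  define E where "E = (\<lambda>z::complex. exp (of_real x * z))"
  define q where "q = (\<lambda>z. y\<^sup>2 / (z\<^sup>2 - 1))"
  define k where "k = 1 / (2 * of_real pi * \<i> :: complex)"
  let ?I = "contour_integral (circlepath 0 R)"
  have R: "1 < R" "norm w < R"
    by (auto simp: R_def intro: add_pos_nonneg add_nonneg_pos)
  have "(norm y + 2)\<^sup>2 \<le> R\<^sup>2"
    by (intro power_mono) (auto simp: R_def)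
  then have yR: "(norm y)\<^sup>2 < R\<^sup>2 - 1"
    by (simp add: power2_sum) (smt (verit) norm_ge_zero)
  then have R2: "0 < R\<^sup>2 - 1"
    using zero_le_power2[of "norm y"] by linarith
  have C: "C < 1"
    using yR R2 by (simp add: C_def)
  have norm: "R\<^sup>2 - 1 \<le> norm (z\<^sup>2 - 1)" if "z \<in> sphere 0 R" for z :: complex
    using norm_triangle_ineq2[of "z\<^sup>2" 1] that by (simp add: norm_power)
  have nz: "z\<^sup>2 - 1 \<noteq> 0" if "z \<in> sphere 0 R" for z :: complex
    using norm[OF that] R2 by auto
  have nzw: "z\<^sup>2 - w\<^sup>2 \<noteq> 0" if "z \<in> sphere 0 R" for z
    using that R(2) by (auto simp: power2_eq_iff)
  have qC: "norm (q z) \<le> C" if "z \<in> sphere 0 R" for z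
    using norm[OF that] R2
    by (auto simp: q_def C_def norm_divide norm_power intro!: divide_left_mono mult_pos_pos)
  have cq: "continuous_on (sphere 0 R) q"
    unfolding q_def by (intro continuous_intros) (use nz in auto)
  have path: "path_image (circlepath 0 R) = sphere (0::complex) R"
    using R by auto
  have fac: "(z - 1) * (z + 1) = z\<^sup>2 - 1" for z :: complex
    by (simp add: power2_eq_square algebra_simps)
  \<comment> \<open>The relation between \<open>w\<close> and \<open>y\<close> enters here: summing
    the geometric series trades the denominator \<open>z\<^sup>2 - 1\<close> for
    \<open>z\<^sup>2 - w\<^sup>2\<close>.\<close>
  have q1: "1 - q z = (z\<^sup>2 - w\<^sup>2) / (z\<^sup>2 - 1)" if "z \<in> sphere 0 R" for z
    using nz[OF that] assms(2) by (simp add: q_def field_simps)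

  \<comment> \<open>Common to both parities: \<open>i\<close> is the parity, and the numerator
    \<open>a\<close> will be \<open>y\<close> for odd and \<open>z + 1\<close> for even
    indices.\<close>
  have sums: "(\<lambda>s. Phi r (2 * s + i) x * y ^ (2 * s + i)) sums (k * ?I (\<lambda>z. E z * a z / (z\<^sup>2 - w\<^sup>2)))"
    if a: "continuous_on (sphere 0 R) a"
      and Phi: "\<And>s. Phi R (2 * s + i) x * y ^ (2 * s + i) =
        k * ?I (\<lambda>z. E z * a z / (z\<^sup>2 - 1) * q z ^ s)" for i a
  proof -
    have "(\<lambda>s. ?I (\<lambda>z. E z * a z / (z\<^sup>2 - 1) * q z ^ s)) sums
        ?I (\<lambda>z. E z * a z / (z\<^sup>2 - 1) / (1 - q z))"
      using R C qC cq a nz unfolding E_def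
      by (intro contour_integral_circlepath_geometric_sums continuous_intros) auto
    moreover have "?I (\<lambda>z. E z * a z / (z\<^sup>2 - 1) / (1 - q z)) = ?I (\<lambda>z. E z * a z / (z\<^sup>2 - w\<^sup>2))"
    proof (intro contour_integral_cong refl)
      fix z assume "z \<in> path_image (circlepath 0 R)"
      then have "z \<in> sphere 0 R"
        by (simp only: path)
      then show "E z * a z / (z\<^sup>2 - 1) / (1 - q z) = E z * a z / (z\<^sup>2 - w\<^sup>2)"
        using nz[of z] by (simp add: q1)
    qed
    ultimately show ?thesis
      using Phi_radius_cong[OF assms(1) R(1)] by (auto simp: Phi intro: sums_mult)
  qed
  have mult: "?I (\<lambda>z. E z / ((z - 1) ^ (s + 1) * (z + 1) ^ t)) * c =
      ?I (\<lambda>z. E z / ((z - 1) ^ (s + 1) * (z + 1) ^ t) * c)" for s t c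
    using R nz unfolding E_def
    by (intro contour_integral_rmul[symmetric] contour_integrable_continuous_circlepath
        continuous_intros) (auto simp: path simp flip: fac)
  have odd: "(\<lambda>s. Phi r (2 * s + 1) x * y ^ (2 * s + 1)) sums
      (k * ?I (\<lambda>z. E z * y / (z\<^sup>2 - w\<^sup>2)))"
  proof (rule sums)
    fix s
    have "Phi R (2 * s + 1) x * y ^ (2 * s + 1) =
        k * (?I (\<lambda>z. E z / ((z - 1) ^ (s + 1) * (z + 1) ^ (s + 1))) * y ^ (2 * s + 1))"
      by (simp add: Phi_def k_def E_def)
    also have "\<dots> = k * ?I (\<lambda>z. E z * y / (z\<^sup>2 - 1) * q z ^ s)"
      unfolding mult
      by (simp add: q_def power_divide power_mult power_mult_distrib flip: fac) (simp add: mult_ac)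
    finally show "Phi R (2 * s + 1) x * y ^ (2 * s + 1) =
        k * ?I (\<lambda>z. E z * y / (z\<^sup>2 - 1) * q z ^ s)" .
  qed auto
  \<comment> \<open>The summand 0 is kept so that the rule \<open>sums\<close> matches with
    \<open>i = 0\<close>.\<close>
  have even: "(\<lambda>s. Phi r (2 * s + 0) x * y ^ (2 * s + 0)) sums
      (k * ?I (\<lambda>z. E z * (z + 1) / (z\<^sup>2 - w\<^sup>2)))"
  proof (rule sums)
    fix s
    have "Phi R (2 * s + 0) x * y ^ (2 * s + 0) =
        k * (?I (\<lambda>z. E z / ((z - 1) ^ (s + 1) * (z + 1) ^ s)) * y ^ (2 * s))"
      by (simp add: Phi_def k_def E_def)
    also have "\<dots> = k * ?I (\<lambda>z. E z * (z + 1) / (z\<^sup>2 - 1) * q z ^ s)"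
      unfolding mult
    \<comment> \<open>The fraction is expanded by \<open>z + 1\<close> to reach the denominator
      \<open>(z\<^sup>2 - 1) ^ (s + 1)\<close>. This needs \<open>z + 1\<close> nonzero, so the
      integrands are compared only on the circle; in the odd case they agree everywhere.\<close>
    proof (intro arg_cong[where f = "(*) k"] contour_integral_cong refl)
      fix z assume "z \<in> path_image (circlepath 0 R)"
      then have "z - 1 \<noteq> 0" "z + 1 \<noteq> 0"
        using nz[of z] R by (auto simp flip: fac)
      then show "E z / ((z - 1) ^ (s + 1) * (z + 1) ^ s) * y ^ (2 * s) =
          E z * (z + 1) / (z\<^sup>2 - 1) * q z ^ s"
        by (simp add: q_def power_divide power_mult power_mult_distrib flip: fac)
    qed
    finally show "Phi R (2 * s + 0) x * y ^ (2 * s + 0) =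
        k * ?I (\<lambda>z. E z * (z + 1) / (z\<^sup>2 - 1) * q z ^ s)" .
  qed (intro continuous_intros)
  have "?I (\<lambda>z. E z * y / (z\<^sup>2 - w\<^sup>2)) + ?I (\<lambda>z. E z * (z + 1) / (z\<^sup>2 - w\<^sup>2)) =
      ?I (\<lambda>z. E z * y / (z\<^sup>2 - w\<^sup>2) + E z * (z + 1) / (z\<^sup>2 - w\<^sup>2))"
    using R nzw unfolding E_def
    by (intro contour_integral_add[symmetric] contour_integrable_continuous_circlepath
        continuous_intros) (auto simp: path)
  \<comment> \<open>The numerators add up to \<open>b + z\<close> with
    \<open>b = 1 + y\<close>.\<close>
  also have "\<dots> = ?I (\<lambda>z. exp (of_real x * z) * (1 + y + z) / (z\<^sup>2 - w\<^sup>2))"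
    by (simp add: E_def algebra_simps flip: add_divide_distrib)
  also have "\<dots> = 2 * of_real pi * \<i> * ((1 + y) * sinh_quot x w + cosh (of_real x * w))"
    by (intro contour_integral_unique has_contour_integral_exp_div_squares R)
  finally have "k * ?I (\<lambda>z. E z * y / (z\<^sup>2 - w\<^sup>2)) + k * ?I (\<lambda>z. E z * (z + 1) / (z\<^sup>2 - w\<^sup>2)) =
      (1 + y) * sinh_quot x w + cosh (of_real x * w)"
    by (simp add: k_def flip: add_divide_distrib)
  with odd even show ?thesis
    by (simp add: sums_iff)
qed

end
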